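(* Let $n$ be a positive integer and let $H \subset \mathbb{R}^n$ be an $n$-dimensional hypercube of edge length $a>0$. For each positive integer $m$, let $q_n(m)$ be the ratio of the arithmetic mean of the volumes of all grid hypercuboids of $H$ (for the grid dividing each edge of $H$ into $m$ equal segments) to the volume $a^n$ of $H$. Then the value $q_n = \lim_{m\to\infty} q_n(m)$ of the ratio of the volume of a normal-sized hypercuboid to the volume of $H$ is \[ q_n = \frac{1}{3^n}. \]
   Context: Write the hypercube as $H=\{v+\sum_{i=1}^n t_i e_i : 0\le t_i\le a\}$, where $v\in\mathbb{R}^n$ is a vertex and $e_1,\dots,e_n$ is an orthonormal basis of $\mathbb{R}^n$ consisting of the directions of the edges. Draw grid lines parallel to the edges dividing each edge of $H$ into $m$ equal segments. The grid hypercuboids of $H$ are all $n$-dimensional hypercuboids in $H$ whose edges lie on the grid lines or the boundary, that is, all sets $\{v+\sum_{i=1}^n t_i e_i : \frac{a}{m}k_i\le t_i\le \frac{a}{m}l_i \text{ for all } i\}$ with integers $0\le k_i<l_i\le m$ for $1\le i\le n$. Distinct such sets are counted separately (each once) in the arithmetic mean. A hypercuboid is called normal-sized if its volume is $q_n a^n$, where $q_n=\lim_{m\to\infty}q_n(m)$. *)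

theory Defs
  imports "HOL-Analysis.Analysis"
begin

definition orthonormal_basis :: "('n::finite \<Rightarrow> real ^ 'n) \<Rightarrow> bool" where
  "orthonormal_basis e \<longleftrightarrow>
     (\<forall>i j. e i \<bullet> e j = (if i = j then 1 else 0)) \<and> span (range e) = UNIV"

abbreviation volume :: "(real ^ 'n::finite) set \<Rightarrow> real" where
  "volume S \<equiv> measure lebesgue S"

definition cuboid ::
    "real ^ 'n \<Rightarrow> ('n::finite \<Rightarrow> real ^ 'n) \<Rightarrow> ('n \<Rightarrow> real) \<Rightarrow> ('n \<Rightarrow> real) \<Rightarrow> (real ^ 'n) set" where
  "cuboid v e b c = {v + (\<Sum>i\<in>UNIV. t i *\<^sub>R e i) | t. \<forall>i. b i \<le> t i \<and> t i \<le> c i}"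

definition hypercuboid :: "(real ^ 'n::finite) set \<Rightarrow> bool" where
  "hypercuboid C \<longleftrightarrow>
     (\<exists>v e b c. orthonormal_basis e \<and> (\<forall>i. b i < c i) \<and> C = cuboid v e b c)"

definition hypercube ::
    "real ^ 'n \<Rightarrow> ('n::finite \<Rightarrow> real ^ 'n) \<Rightarrow> real \<Rightarrow> (real ^ 'n) set" where
  "hypercube v e a = {v + (\<Sum>i\<in>UNIV. t i *\<^sub>R e i) | t. \<forall>i. 0 \<le> t i \<and> t i \<le> a}"

text \<open>A set of point sets, so cuboids arising from different bounds \<open>k\<close>, \<open>l\<close> are counted
  separately exactly when they differ as sets.\<close>

definition grid_hypercuboids ::
    "real ^ 'n \<Rightarrow> ('n::finite \<Rightarrow> real ^ 'n) \<Rightarrow> real \<Rightarrow> nat \<Rightarrow> (real ^ 'n) set set" where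
  "grid_hypercuboids v e a m =
     {cuboid v e (\<lambda>i. a / real m * real (k i)) (\<lambda>i. a / real m * real (l i)) | k l :: 'n \<Rightarrow> nat.
        \<forall>i. k i < l i \<and> l i \<le> m}"

text \<open>Only meaningful for \<open>m > 0\<close>: for \<open>m = 0\<close> there are no grid hypercuboids and the value is
  the junk value \<open>0\<close>, which does not affect the limit.\<close>

definition mean_volume_ratio ::
    "real ^ 'n \<Rightarrow> ('n::finite \<Rightarrow> real ^ 'n) \<Rightarrow> real \<Rightarrow> nat \<Rightarrow> real" where
  "mean_volume_ratio v e a m =
     ((\<Sum>C\<in>grid_hypercuboids v e a m. volume C) / real (card (grid_hypercuboids v e a m)))
       / volume (hypercube v e a)"

definition normal_ratio ::
    "real ^ 'n \<Rightarrow> ('n::finite \<Rightarrow> real ^ 'n) \<Rightarrow> real \<Rightarrow> real" where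
  "normal_ratio v e a = lim (\<lambda>m. mean_volume_ratio v e a m)"

definition normal_sized ::
    "real ^ 'n \<Rightarrow> ('n::finite \<Rightarrow> real ^ 'n) \<Rightarrow> real \<Rightarrow> (real ^ 'n) set \<Rightarrow> bool" where
  "normal_sized v e a C \<longleftrightarrow>
     hypercuboid C \<and> volume C = normal_ratio v e a * a ^ CARD('n)"

end

theory Submission
  imports Defs
begin

text \<open>A grid hypercuboid is a product of grid intervals, and its volume is the product of their
  lengths, so the mean volume is the \<open>n\<close>-th power of the mean length of a grid interval. The
  \<open>m (m + 1) / 2\<close> grid intervals have total length \<open>a/m \<cdot> m (m + 1) (m + 2) / 6\<close>, hence mean length
  \<open>a (m + 2) / (3 m)\<close>.\<close>

section \<open>Invariance of Lebesgue measure under orthogonal maps\<close>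

text \<open>The library's \<open>measure_orthogonal_image\<close> requires a well-ordered index type. Without one, cover an open
  set up to a null set by disjoint balls (Vitali): an orthogonal map sends balls to balls of the
  same radius.\<close>

lemma emeasure_orthogonal_image_open:
  fixes f :: "'a::euclidean_space \<Rightarrow> 'a"
  assumes f: "orthogonal_transformation f" and S: "open S"
  shows "emeasure lebesgue (f ` S) = emeasure lebesgue S"
proof -
  define K where "K = {(x, r). 0 < r \<and> cball x r \<subseteq> S}"
  have cover: "\<exists>i. i \<in> K \<and> x \<in> cball (fst i) (snd i) \<and> snd i < d" if "x \<in> S" "0 < d" for x d
  proof -
    obtain r where "0 < r" "cball x r \<subseteq> S"
      using S \<open>x \<in> S\<close> by (meson open_contains_cball)
    \<comment> \<open>The bound \<open>r\<close> keeps the ball inside \<open>S\<close>, and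
      \<open>d / 2\<close> keeps its radius strictly below \<open>d\<close>.\<close>
    then show ?thesis
      using \<open>0 < d\<close> unfolding K_def
      by (intro exI[of _ "(x, min r (d / 2))"]) auto
  qed
  obtain C where C: "countable C" "C \<subseteq> K"
    and disj: "pairwise (\<lambda>i j. disjnt (cball (fst i) (snd i)) (cball (fst j) (snd j))) C"
    and neg: "negligible (S - (\<Union>i\<in>C. cball (fst i) (snd i)))"
    by (rule Vitali_covering_theorem_cballs[of K snd S fst, OF _ cover])
       (auto simp: K_def case_prod_beta)
  let ?B = "\<lambda>i. cball (fst i) (snd i)"
  define N where "N = S - (\<Union>i\<in>C. ?B i)"
  have "?B i \<subseteq> S" if "i \<in> C" for i
    using subsetD[OF C(2) that] by (simp add: K_def case_prod_beta)
  then have S_eq: "S = (\<Union>i\<in>C. ?B i) \<union> N"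
    unfolding N_def by blast
  have ball_image: "f ` ?B i = cball (f (fst i)) (snd i)" for i
    by (rule image_orthogonal_transformation_cball[OF f])
  have disj_B: "disjoint_family_on ?B C"
    using disj by (auto simp: disjoint_family_on_def pairwise_def disjnt_def)
  have disj_fB: "disjoint_family_on (\<lambda>i. f ` ?B i) C"
    using disj_B orthogonal_transformation_inj[OF f]
    by (simp add: disjoint_family_on_def flip: image_Int)
  have "negligible (f ` N)"
    using neg orthogonal_transformation_linear[OF f] unfolding N_def
    by (intro negligible_differentiable_image_negligible)
       (auto intro: linear_imp_differentiable_on)
  then have null: "f ` N \<in> null_sets lebesgue" "N \<in> null_sets lebesgue"
    using neg by (simp_all add: N_def negligible_iff_null_sets)
  have "emeasure lebesgue (f ` S) = emeasure lebesgue ((\<Union>i\<in>C. f ` ?B i) \<union> f ` N)"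
    by (subst S_eq) (simp add: image_Un image_UN)
  also have "\<dots> = emeasure lebesgue (\<Union>i\<in>C. f ` ?B i)"
    using C(1) null(1) by (intro emeasure_Un_null_set sets.countable_UN') (auto simp: ball_image)
  also have "\<dots> = (\<integral>\<^sup>+i. emeasure lebesgue (f ` ?B i) \<partial>count_space C)"
    using C(1) disj_fB by (intro emeasure_UN_countable) (simp_all add: ball_image)
  \<comment> \<open>Here the geometry enters: the measure of a ball depends only on its radius,
    which \<open>f\<close> preserves.\<close>
  also have "\<dots> = (\<integral>\<^sup>+i. emeasure lebesgue (?B i) \<partial>count_space C)"
    using C(2) by (intro nn_integral_cong) (auto simp: ball_image emeasure_cball K_def)
  also have "\<dots> = emeasure lebesgue (\<Union>i\<in>C. ?B i)"
    using C(1) disj_B by (intro emeasure_UN_countable[symmetric]) simp_all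
  also have "\<dots> = emeasure lebesgue S"
    using C(1) null(2)
    by (subst S_eq) (intro emeasure_Un_null_set[symmetric] sets.countable_UN', auto)
  finally show ?thesis .
qed

text \<open>The closed and the open box differ by a frontier, which is null and has a null image, so
  the open case suffices.\<close>

lemma measure_orthogonal_image_cbox:
  fixes f :: "'a::euclidean_space \<Rightarrow> 'a"
  assumes f: "orthogonal_transformation f"
  shows "measure lebesgue (f ` cbox a b) = measure lebesgue (cbox a b)"
proof -
  have lin: "linear f"
    using f by (rule orthogonal_transformation_linear)
  have "negligible (f ` (cbox a b - box a b))"
    using lin by (intro negligible_differentiable_image_negligible negligible_frontier_interval)
      (auto intro: linear_imp_differentiable_on)
  then have "negligible (f ` cbox a b - f ` box a b \<union> (f ` box a b - f ` cbox a b))"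
    by (rule negligible_subset) (use box_subset_cbox in blast)
  moreover have "f ` cbox a b \<in> lmeasurable"
    using lin by (intro lmeasurable_compact compact_continuous_image)
      (simp_all add: linear_continuous_on linear_linear)
  ultimately have "measure lebesgue (f ` cbox a b) = measure lebesgue (f ` box a b)"
    by (intro measure_negligible_symdiff[symmetric])
  also have "\<dots> = measure lebesgue (box a b)"
    by (simp only: measure_def emeasure_orthogonal_image_open[OF f open_box])
  also have "\<dots> = measure lebesgue (cbox a b)"
    by (simp add: measure_lborel_box_eq measure_lborel_cbox_eq)
  finally show ?thesis .
qed

section \<open>Cuboids in an orthonormal frame\<close>

definition frame_map :: "('n::finite \<Rightarrow> real ^ 'n) \<Rightarrow> real ^ 'n \<Rightarrow> real ^ 'n" where
  "frame_map e x = (\<Sum>i\<in>UNIV. x $ i *\<^sub>R e i)"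

lemma orthogonal_transformation_frame_map:
  fixes e :: "'n::finite \<Rightarrow> real ^ 'n"
  assumes "orthonormal_basis e"
  shows "orthogonal_transformation (frame_map e)"
  unfolding orthogonal_transformation_def
proof (intro conjI allI)
  show "linear (frame_map e)"
    unfolding frame_map_def
    by (intro linearI)
       (simp_all add: scaleR_add_left sum.distrib scaleR_sum_right)
  show "frame_map e x \<bullet> frame_map e y = x \<bullet> y" for x y
  proof -
    have ortho: "e i \<bullet> e j = (if i = j then 1 else 0)" for i j
      using assms by (simp add: orthonormal_basis_def)
    have "frame_map e x \<bullet> frame_map e y = (\<Sum>i\<in>UNIV. x $ i * y $ i)"
      by (simp add: frame_map_def inner_sum_left inner_sum_right ortho if_distrib
          mult.commute cong: if_cong)
    then show ?thesis
      by (simp add: inner_vec_def)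
  qed
qed

text \<open>This splits a cuboid into a translation, an orthogonal map and an axis-parallel box, so
  that volumes and equality of cuboids reduce to those of boxes.\<close>

lemma cuboid_eq_image_cbox:
  "cuboid v e b c = (+) v ` frame_map e ` cbox (\<chi> i. b i) (\<chi> i. c i)"
proof
  show "cuboid v e b c \<subseteq> (+) v ` frame_map e ` cbox (\<chi> i. b i) (\<chi> i. c i)"
  proof
    fix x assume "x \<in> cuboid v e b c"
    then obtain t where t: "\<forall>i. b i \<le> t i \<and> t i \<le> c i"
      and x: "x = v + (\<Sum>i\<in>UNIV. t i *\<^sub>R e i)"
      by (auto simp: cuboid_def)
    have "x = v + frame_map e (\<chi> i. t i)" "(\<chi> i. t i) \<in> cbox (\<chi> i. b i) (\<chi> i. c i)"
      using t x by (simp_all add: frame_map_def mem_box_cart)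
    then show "x \<in> (+) v ` frame_map e ` cbox (\<chi> i. b i) (\<chi> i. c i)"
      by blast
  qed
qed (auto simp: cuboid_def frame_map_def mem_box_cart)

lemma volume_cuboid:
  fixes e :: "'n::finite \<Rightarrow> real ^ 'n"
  assumes "orthonormal_basis e" and "\<And>i. b i \<le> c i"
  shows "volume (cuboid v e b c) = (\<Prod>i\<in>UNIV. c i - b i)"
proof -
  let ?B = "cbox (\<chi> i. b i) (\<chi> i. c i) :: (real ^ 'n) set"
  have "volume (cuboid v e b c) = volume ?B"
    unfolding cuboid_eq_image_cbox
    by (simp add: measure_translation
        measure_orthogonal_image_cbox orthogonal_transformation_frame_map[OF assms(1)])
  \<comment> \<open>The content of a box is the product of its side lengths only when the box is
    nonempty.\<close>
  moreover have "?B \<noteq> {}"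
    using assms(2) by (simp add: interval_ne_empty_cart)
  ultimately show ?thesis
    by (simp add: content_cbox_cart)
qed

text \<open>The mean runs over point sets, so counting them requires recovering the bounds from the
  set. A nonempty box determines its corners, and the frame map and translation are
  injective.\<close>

lemma cuboid_eq_iff:
  fixes e :: "'n::finite \<Rightarrow> real ^ 'n"
  assumes "orthonormal_basis e" and "\<And>i. b i \<le> c i"
  shows "cuboid v e b c = cuboid v e b' c' \<longleftrightarrow> b = b' \<and> c = c'"
proof -
  let ?B = "cbox (\<chi> i. b i) (\<chi> i. c i) :: (real ^ 'n) set"
  have "inj (frame_map e)"
    using orthogonal_transformation_frame_map[OF assms(1)]
    by (rule orthogonal_transformation_inj)
  then have "cuboid v e b c = cuboid v e b' c' \<longleftrightarrow> ?B = cbox (\<chi> i. b' i) (\<chi> i. c' i)"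
    unfolding cuboid_eq_image_cbox by (simp add: inj_image_eq_iff)
  moreover have "?B \<noteq> {}"
    using assms(2) by (simp add: interval_ne_empty_cart)
  ultimately show ?thesis
    by (auto simp: eq_cbox vec_eq_iff)
qed

section \<open>Number and total length of the grid intervals\<close>

text \<open>Pairs are stored with the upper bound first, so that they form a dependent sum.\<close>

definition grid_intervals :: "nat \<Rightarrow> (nat \<times> nat) set" where
  "grid_intervals m = (SIGMA l:{..m}. {..<l})"

lemma finite_grid_intervals: "finite (grid_intervals m)"
  by (simp add: grid_intervals_def)

lemma card_grid_intervals: "real (card (grid_intervals m)) = real m * (real m + 1) / 2"
proof -
  have "card (grid_intervals m) = (\<Sum>l\<le>m. l)"
    by (simp add: grid_intervals_def)
  also have "real \<dots> = real m * (real m + 1) / 2"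
    by (induction m) (simp_all add: field_simps)
  finally show ?thesis .
qed

lemma sum_length_grid_intervals:
  "(\<Sum>(l, k)\<in>grid_intervals m. real l - real k) = real m * (real m + 1) * (real m + 2) / 6"
proof -
  \<comment> \<open>The minuend \<open>x\<close> is kept independent of \<open>l\<close> so that the
    induction on \<open>l\<close> goes through; it is used with \<open>x = real l\<close>, where the
    value is the triangular number \<open>l (l + 1) / 2\<close>.\<close>
  have inner: "(\<Sum>k<l. x - real k) = real l * x - real l * (real l - 1) / 2" for l x
    by (induction l) (simp_all add: field_simps)
  have "(\<Sum>(l, k)\<in>grid_intervals m. real l - real k) = (\<Sum>l\<le>m. \<Sum>k<l. real l - real k)"
    by (simp add: grid_intervals_def sum.Sigma)
  also have "\<dots> = real m * (real m + 1) * (real m + 2) / 6"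
    unfolding inner by (induction m) (simp_all add: field_simps)
  finally show ?thesis .
qed

section \<open>Grid hypercuboids as products of grid intervals\<close>

text \<open>A single function into pairs replaces the two functions \<open>k\<close> and
  \<open>l\<close>, so that the parameters range over a plain function space.\<close>

definition grid_cuboid ::
    "real ^ 'n \<Rightarrow> ('n::finite \<Rightarrow> real ^ 'n) \<Rightarrow> real \<Rightarrow> nat \<Rightarrow> ('n \<Rightarrow> nat \<times> nat) \<Rightarrow> (real ^ 'n) set" where
  "grid_cuboid v e a m g =
     cuboid v e (\<lambda>i. a / real m * real (snd (g i))) (\<lambda>i. a / real m * real (fst (g i)))"

text \<open>The constraints on \<open>k\<close> and \<open>l\<close> are imposed coordinate by
  coordinate. The resulting product structure is what makes both the count and the total volume
  \<open>n\<close>-th powers.\<close>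

lemma grid_hypercuboids_eq_image:
  "grid_hypercuboids v e a m = grid_cuboid v e a m ` (UNIV \<rightarrow>\<^sub>E grid_intervals m)"
proof
  show "grid_hypercuboids v e a m \<subseteq> grid_cuboid v e a m ` (UNIV \<rightarrow>\<^sub>E grid_intervals m)"
  proof
    fix C assume "C \<in> grid_hypercuboids v e a m"
    then obtain k l where kl: "\<forall>i. k i < l i \<and> l i \<le> m"
      and C: "C = cuboid v e (\<lambda>i. a / real m * real (k i)) (\<lambda>i. a / real m * real (l i))"
      by (auto simp: grid_hypercuboids_def)
    have "C = grid_cuboid v e a m (\<lambda>i. (l i, k i))"
      by (simp add: C grid_cuboid_def)
    moreover have "(\<lambda>i. (l i, k i)) \<in> UNIV \<rightarrow>\<^sub>E grid_intervals m"
      using kl by (auto simp: grid_intervals_def)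
    ultimately show "C \<in> grid_cuboid v e a m ` (UNIV \<rightarrow>\<^sub>E grid_intervals m)"
      by blast
  qed
  show "grid_cuboid v e a m ` (UNIV \<rightarrow>\<^sub>E grid_intervals m) \<subseteq> grid_hypercuboids v e a m"
  proof
    fix C assume "C \<in> grid_cuboid v e a m ` (UNIV \<rightarrow>\<^sub>E grid_intervals m)"
    then obtain g where g: "g \<in> UNIV \<rightarrow>\<^sub>E grid_intervals m" and C: "C = grid_cuboid v e a m g"
      by blast
    have "snd (g i) < fst (g i) \<and> fst (g i) \<le> m" for i
      using PiE_mem[OF g, of i] by (auto simp: grid_intervals_def)
    then show "C \<in> grid_hypercuboids v e a m"
      unfolding grid_hypercuboids_def C grid_cuboid_def
      by (intro CollectI exI[of _ "\<lambda>i. snd (g i)"] exI[of _ "\<lambda>i. fst (g i)"]) simp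
  qed
qed

lemma grid_bounds_le:
  assumes "g \<in> UNIV \<rightarrow>\<^sub>E grid_intervals m" and "a > 0"
  shows "a / real m * real (snd (g i)) \<le> a / real m * real (fst (g i))"
proof -
  have "snd (g i) \<le> fst (g i)"
    using PiE_mem[OF assms(1), of i] by (auto simp: grid_intervals_def)
  then show ?thesis
    using assms(2) by (intro mult_left_mono) simp_all
qed

lemma inj_on_grid_cuboid:
  assumes "orthonormal_basis e" and "a > 0" and "m > 0"
  shows "inj_on (grid_cuboid v e a m) (UNIV \<rightarrow>\<^sub>E grid_intervals m)"
proof (rule inj_onI)
  fix g h assume g: "g \<in> UNIV \<rightarrow>\<^sub>E grid_intervals m"
    and eq: "grid_cuboid v e a m g = grid_cuboid v e a m h"
  have "(\<lambda>i. a / real m * real (snd (g i))) = (\<lambda>i. a / real m * real (snd (h i))) \<and>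
      (\<lambda>i. a / real m * real (fst (g i))) = (\<lambda>i. a / real m * real (fst (h i)))"
    by (rule iffD1[OF cuboid_eq_iff, OF assms(1) _ eq[unfolded grid_cuboid_def]])
       (rule grid_bounds_le[OF g assms(2)])
  \<comment> \<open>The common factor \<open>a / real m\<close> is nonzero and cancels.\<close>
  then show "g = h"
    using assms(2,3) by (auto simp: fun_eq_iff prod_eq_iff)
qed

lemma card_grid_hypercuboids:
  fixes e :: "'n::finite \<Rightarrow> real ^ 'n"
  assumes "orthonormal_basis e" and "a > 0" and "m > 0"
  shows "card (grid_hypercuboids v e a m) = card (grid_intervals m) ^ CARD('n)"
  unfolding grid_hypercuboids_eq_image
  by (simp add: card_image[OF inj_on_grid_cuboid[OF assms]] card_PiE)

lemma sum_volume_grid_hypercuboids: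
  fixes e :: "'n::finite \<Rightarrow> real ^ 'n"
  assumes "orthonormal_basis e" and "a > 0" and "m > 0"
  shows "(\<Sum>C\<in>grid_hypercuboids v e a m. volume C) =
    (a / real m * (\<Sum>(l, k)\<in>grid_intervals m. real l - real k)) ^ CARD('n)"
proof -
  let ?I = "UNIV \<rightarrow>\<^sub>E grid_intervals m :: ('n \<Rightarrow> nat \<times> nat) set"
  let ?len = "\<lambda>p::nat \<times> nat. a / real m * (real (fst p) - real (snd p))"
  have "(\<Sum>C\<in>grid_hypercuboids v e a m. volume C) = (\<Sum>g\<in>?I. volume (grid_cuboid v e a m g))"
    unfolding grid_hypercuboids_eq_image
    by (simp add: sum.reindex[OF inj_on_grid_cuboid[OF assms]])
  also have "\<dots> = (\<Sum>g\<in>?I. \<Prod>i\<in>UNIV. ?len (g i))"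
  proof (rule sum.cong)
    fix g assume "g \<in> ?I"
    then have "a / real m * real (snd (g i)) \<le> a / real m * real (fst (g i))" for i
      using assms(2) by (rule grid_bounds_le)
    from volume_cuboid[OF assms(1) this]
    show "volume (grid_cuboid v e a m g) = (\<Prod>i\<in>UNIV. ?len (g i))"
      unfolding grid_cuboid_def by (simp only: right_diff_distrib)
  qed simp
  \<comment> \<open>Distributivity: summing products over all choice functions gives a product of
    sums, whose factors are all equal.\<close>
  also have "\<dots> = (\<Prod>i\<in>(UNIV::'n set). \<Sum>p\<in>grid_intervals m. ?len p)"
    by (subst prod_sum_PiE) (simp_all add: finite_grid_intervals)
  also have "\<dots> = (a / real m * (\<Sum>(l, k)\<in>grid_intervals m. real l - real k)) ^ CARD('n)"
    by (simp add: sum_distrib_left case_prod_beta)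
  finally show ?thesis .
qed

section \<open>The mean volume ratio and its limit\<close>

lemma volume_hypercube:
  fixes e :: "'n::finite \<Rightarrow> real ^ 'n"
  assumes "orthonormal_basis e" and "a > 0"
  shows "volume (hypercube v e a) = a ^ CARD('n)"
proof -
  have "hypercube v e a = cuboid v e (\<lambda>_. 0) (\<lambda>_. a)"
    by (simp add: hypercube_def cuboid_def)
  then show ?thesis
    using assms by (simp add: volume_cuboid)
qed

text \<open>Total volume, count and the volume of the hypercube are all \<open>n\<close>-th powers,
  so the ratio is the \<open>n\<close>-th power of its one-dimensional value.\<close>

lemma mean_volume_ratio_eq:
  fixes e :: "'n::finite \<Rightarrow> real ^ 'n"
  assumes "orthonormal_basis e" and "a > 0" and "m > 0"
  shows "mean_volume_ratio v e a m = ((real m + 2) / (3 * real m)) ^ CARD('n)"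
proof -
  have "mean_volume_ratio v e a m =
      (a / real m * (\<Sum>(l, k)\<in>grid_intervals m. real l - real k)
        / real (card (grid_intervals m)) / a) ^ CARD('n)"
    by (simp add: mean_volume_ratio_def card_grid_hypercuboids[OF assms]
        sum_volume_grid_hypercuboids[OF assms] volume_hypercube[OF assms(1,2)]
        power_divide power_mult_distrib)
  also have "a / real m * (\<Sum>(l, k)\<in>grid_intervals m. real l - real k)
        / real (card (grid_intervals m)) / a = (real m + 2) / (3 * real m)"
    unfolding card_grid_intervals sum_length_grid_intervals
    using assms(2,3) by (simp add: divide_simps)
  finally show ?thesis .
qed

lemma mean_volume_ratio_tendsto:
  fixes e :: "'n::finite \<Rightarrow> real ^ 'n"
  assumes "orthonormal_basis e" and "a > 0"
  shows "mean_volume_ratio v e a \<longlonglongrightarrow> 1 / 3 ^ CARD('n)"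
proof -
  \<comment> \<open>The base is \<open>(m + 2) / (3 m)\<close> with \<open>m\<close> divided
    out.\<close>
  have "(\<lambda>m. (1 / 3 + 2 / 3 * inverse (real m)) ^ CARD('n))
      \<longlonglongrightarrow> (1 / 3 + 2 / 3 * 0) ^ CARD('n)"
    by (intro tendsto_intros lim_inverse_n)
  \<comment> \<open>Agreement fails at \<open>m = 0\<close>: there \<open>inverse 0 = 0\<close>
    makes the left side a power of \<open>1 / 3\<close>, while the mean has its default value
    \<open>0\<close>.\<close>
  moreover have "eventually (\<lambda>m. (1 / 3 + 2 / 3 * inverse (real m)) ^ CARD('n)
      = mean_volume_ratio v e a m) sequentially"
    using eventually_gt_at_top[of 0]
    by eventually_elim
       (simp add: mean_volume_ratio_eq[OF assms] field_simps)
  ultimately have "mean_volume_ratio v e a \<longlonglongrightarrow> (1 / 3 + 2 / 3 * 0) ^ CARD('n)"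
    by (rule Lim_transform_eventually)
  then show ?thesis
    by (simp add: power_one_over)
qed

theorem theorem1:
  fixes v :: "real ^ 'n::finite" and e :: "'n \<Rightarrow> real ^ 'n" and a :: real
  assumes "orthonormal_basis e" and "a > 0"
  shows "convergent (\<lambda>m. mean_volume_ratio v e a m)
    \<and> normal_ratio v e a = 1 / 3 ^ CARD('n)
    \<and> (\<forall>C. normal_sized v e a C \<longrightarrow> volume C / volume (hypercube v e a) = 1 / 3 ^ CARD('n))"
proof -
  note lim = mean_volume_ratio_tendsto[OF assms, of v]
  have "normal_ratio v e a = 1 / 3 ^ CARD('n)"
    unfolding normal_ratio_def by (rule limI) (rule lim)
  then show ?thesis
    \<comment> \<open>In the last conjunct the factor \<open>a ^ CARD('n)\<close> from
      \<open>normal_sized\<close> cancels against the volume of the hypercube, which is nonzero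
      since \<open>a > 0\<close>.\<close>
    using lim assms(2) by (auto simp: convergent_def normal_sized_def volume_hypercube[OF assms])
qed

end
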